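(* A Landsberg surface (a Landsberg space $(M,F)$ with $\dim M=2$) that admits a (nonzero) parallel 1-form is Berwaldian, i.e. it is a Berwald space.
   Context: $\mathcal{T}M$ is the bundle of nonzero tangent vectors of a smooth $n$-manifold $M$, $(x^i,y^i)$ are the induced coordinates on $TM$, $\partial_i=\partial/\partial x^i$, $\dot\partial_i=\partial/\partial y^i$; the summation convention is used. A Finsler space $(M,F)$ is such an $M$ with a function $F:TM\to\mathbb{R}$ that is strictly positive and smooth on $\mathcal{T}M$, positively 1-homogeneous in $y$, and such that $g_{ij}=\dot\partial_i\dot\partial_j(\tfrac12F^2)$ has rank $n$. Its geodesic spray is $S=y^j\partial_j-2G^j\dot\partial_j$, with $G^i=\tfrac14 g^{il}\left(y^k\partial_k\dot\partial_l F^2-\partial_l F^2\right)$. Put $G^h_j=\dot\partial_jG^h$, $G^h_{ij}=\dot\partial_iG^h_j$ (Berwald connection coefficients), $G^h_{ijk}=\dot\partial_kG^h_{ij}$ (Berwald curvature). $(M,F)$ is a Berwald space if $G^h_{ijk}\equiv0$. The Landsberg curvature is $L_{ijk}=-\tfrac12F\,G^h_{ijk}\,\dot\partial_hF$; $(M,F)$ is a Landsberg space if $L_{ijk}\equiv 0$. A 1-form $\beta=b_i(x)y^i$ is parallel if its Berwald horizontal covariant derivative vanishes: $b_{i|j}=\partial_jb_i-G^h_{ij}b_h=0$ on $\mathcal{T}M$. Parallel 1-forms are understood to be nonzero. *)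

theory Defs
  imports "HOL-Analysis.Analysis"
begin

section \<open>Smooth maps between Euclidean spaces\<close>

fun C_k_on :: "nat \<Rightarrow> ('a::real_normed_vector \<Rightarrow> 'b::real_normed_vector) \<Rightarrow> 'a set \<Rightarrow> bool" where
  "C_k_on 0 f S \<longleftrightarrow> continuous_on S f"
| "C_k_on (Suc k) f S \<longleftrightarrow>
     (\<forall>x\<in>S. f differentiable (at x)) \<and> (\<forall>v. C_k_on k (\<lambda>x. frechet_derivative f (at x) v) S)"

text \<open>Only used for open \<open>S\<close>.\<close>

definition smooth_on :: "('a::real_normed_vector \<Rightarrow> 'b::real_normed_vector) \<Rightarrow> 'a set \<Rightarrow> bool" where
  "smooth_on f S \<longleftrightarrow> (\<forall>k. C_k_on k f S)"

section \<open>Smooth manifolds and their tangent bundles\<close>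

text \<open>
  A chart is a domain together with a coordinate map; the values of the map outside the domain
  are irrelevant. A smooth \<open>n\<close>-manifold is given by an atlas of charts into \<open>real ^ 'n\<close>,
  its underlying space being the union of the chart domains. The Hausdorff and countability
  axioms are imposed through the type classes of the point type. The atlas need not be maximal.
\<close>

type_synonym ('m, 'n) chart = "'m set \<times> ('m \<Rightarrow> real ^ 'n)"

definition is_chart :: "('m::topological_space, 'n::finite) chart \<Rightarrow> bool" where
  "is_chart c \<longleftrightarrow> open (fst c) \<and> open (snd c ` fst c) \<and>
     homeomorphism (fst c) (snd c ` fst c) (snd c) (inv_into (fst c) (snd c))"

definition transition :: "('m, 'n::finite) chart \<Rightarrow> ('m, 'n) chart \<Rightarrow> real ^ 'n \<Rightarrow> real ^ 'n" where
  "transition c d = snd d \<circ> inv_into (fst c) (snd c)"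

definition carrier :: "('m, 'n::finite) chart set \<Rightarrow> 'm set" where
  "carrier A = (\<Union>c\<in>A. fst c)"

definition smooth_manifold ::
    "('m::{t2_space, second_countable_topology}, 'n::finite) chart set \<Rightarrow> bool" where
  "smooth_manifold A \<longleftrightarrow> (\<forall>c\<in>A. is_chart c) \<and>
     (\<forall>c\<in>A. \<forall>d\<in>A. smooth_on (transition c d) (snd c ` (fst c \<inter> fst d)))"

text \<open>
  A tangent vector at \<open>p\<close> is a family of component vectors, one for each chart around \<open>p\<close>,
  transforming by the Jacobians of the transition maps (and set to 0 at the charts not
  containing \<open>p\<close>, so that equality of tangent vectors is equality of functions).
  The zero vector is \<open>\<lambda>_. 0\<close>, and scalar multiplication is componentwise.
\<close>

type_synonym ('m, 'n) tangent_vector = "('m, 'n) chart \<Rightarrow> real ^ 'n"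

definition tangent_space ::
    "('m, 'n::finite) chart set \<Rightarrow> 'm \<Rightarrow> ('m, 'n) tangent_vector set" where
  "tangent_space A p = {v.
     (\<forall>c\<in>A. \<forall>d\<in>A. p \<in> fst c \<longrightarrow> p \<in> fst d \<longrightarrow>
        v d = frechet_derivative (transition c d) (at (snd c p)) (v c)) \<and>
     (\<forall>c. c \<notin> A \<or> p \<notin> fst c \<longrightarrow> v c = 0)}"

definition tangent_bundle ::
    "('m, 'n::finite) chart set \<Rightarrow> ('m \<times> ('m, 'n) tangent_vector) set" where
  "tangent_bundle A = Sigma (carrier A) (tangent_space A)"

definition induced_coords ::
    "('m, 'n::finite) chart \<Rightarrow> 'm \<times> ('m, 'n) tangent_vector \<Rightarrow> (real ^ 'n) \<times> (real ^ 'n)" where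
  "induced_coords c = (\<lambda>(p, v). (snd c p, v c))"

text \<open>
  Coordinate expression \<open>(x, y) \<mapsto> F(x, y)\<close> of a function on the tangent bundle in the
  coordinates induced by the chart \<open>c\<close>; meaningful for \<open>x \<in> snd c ` fst c\<close> and all \<open>y\<close>.
\<close>

definition coord_expr ::
    "('m, 'n::finite) chart set \<Rightarrow> ('m, 'n) chart \<Rightarrow>
     ('m \<times> ('m, 'n) tangent_vector \<Rightarrow> real) \<Rightarrow> (real ^ 'n) \<times> (real ^ 'n) \<Rightarrow> real" where
  "coord_expr A c F = F \<circ> inv_into (Sigma (fst c) (tangent_space A)) (induced_coords c)"

definition slit_domain :: "('m, 'n::finite) chart \<Rightarrow> ((real ^ 'n) \<times> (real ^ 'n)) set" where
  "slit_domain c = (snd c ` fst c) \<times> (- {0})"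

section \<open>Coordinate expressions of the geometric objects of a Finsler space\<close>

text \<open>
  Here \<open>f\<close> is the coordinate expression of the Finsler function,
  \<open>pdx i\<close> is the partial derivative by the \<open>i\<close>-th base coordinate and
  \<open>pdy i\<close> the one by the \<open>i\<close>-th fibre coordinate.
\<close>

definition pdx :: "'n::finite \<Rightarrow> ((real ^ 'n) \<times> (real ^ 'n) \<Rightarrow> real) \<Rightarrow> (real ^ 'n) \<times> (real ^ 'n) \<Rightarrow> real" where
  "pdx i f z = frechet_derivative f (at z) (axis i 1, 0)"

definition pdy :: "'n::finite \<Rightarrow> ((real ^ 'n) \<times> (real ^ 'n) \<Rightarrow> real) \<Rightarrow> (real ^ 'n) \<times> (real ^ 'n) \<Rightarrow> real" where
  "pdy i f z = frechet_derivative f (at z) (0, axis i 1)"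

definition metric_tensor ::
    "((real ^ 'n::finite) \<times> (real ^ 'n) \<Rightarrow> real) \<Rightarrow> (real ^ 'n) \<times> (real ^ 'n) \<Rightarrow> real ^ 'n ^ 'n" where
  "metric_tensor f z = (\<chi> i j. pdy i (pdy j (\<lambda>w. 1/2 * (f w)\<^sup>2)) z)"

definition spray_coeff ::
    "((real ^ 'n::finite) \<times> (real ^ 'n) \<Rightarrow> real) \<Rightarrow> 'n \<Rightarrow> (real ^ 'n) \<times> (real ^ 'n) \<Rightarrow> real" where
  "spray_coeff f i z = 1/4 * (\<Sum>l\<in>UNIV. matrix_inv (metric_tensor f z) $ i $ l *
     ((\<Sum>k\<in>UNIV. snd z $ k * pdx k (pdy l (\<lambda>w. (f w)\<^sup>2)) z) - pdx l (\<lambda>w. (f w)\<^sup>2) z))"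

text \<open>Index order: the upper index comes first, as in \<open>G\<^sup>h\<^sub>i\<^sub>j\<^sub>k\<close>.\<close>

definition berwald_connection ::
    "((real ^ 'n::finite) \<times> (real ^ 'n) \<Rightarrow> real) \<Rightarrow> 'n \<Rightarrow> 'n \<Rightarrow> 'n \<Rightarrow> (real ^ 'n) \<times> (real ^ 'n) \<Rightarrow> real" where
  "berwald_connection f h i j = pdy i (pdy j (spray_coeff f h))"

definition berwald_curvature ::
    "((real ^ 'n::finite) \<times> (real ^ 'n) \<Rightarrow> real) \<Rightarrow> 'n \<Rightarrow> 'n \<Rightarrow> 'n \<Rightarrow> 'n \<Rightarrow> (real ^ 'n) \<times> (real ^ 'n) \<Rightarrow> real" where
  "berwald_curvature f h i j k = pdy k (berwald_connection f h i j)"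

definition landsberg_curvature ::
    "((real ^ 'n::finite) \<times> (real ^ 'n) \<Rightarrow> real) \<Rightarrow> 'n \<Rightarrow> 'n \<Rightarrow> 'n \<Rightarrow> (real ^ 'n) \<times> (real ^ 'n) \<Rightarrow> real" where
  "landsberg_curvature f i j k z =
     - 1/2 * f z * (\<Sum>h\<in>UNIV. berwald_curvature f h i j k z * pdy h f z)"

section \<open>Finsler, Berwald and Landsberg spaces\<close>

definition finsler_space ::
    "('m::{t2_space, second_countable_topology}, 'n::finite) chart set \<Rightarrow>
     ('m \<times> ('m, 'n) tangent_vector \<Rightarrow> real) \<Rightarrow> bool" where
  "finsler_space A F \<longleftrightarrow> smooth_manifold A \<and>
     (\<forall>(p, v)\<in>tangent_bundle A. v \<noteq> (\<lambda>_. 0) \<longrightarrow> F (p, v) > 0) \<and>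
     (\<forall>(p, v)\<in>tangent_bundle A. \<forall>r>0. F (p, \<lambda>c. r *\<^sub>R v c) = r * F (p, v)) \<and>
     (\<forall>c\<in>A. smooth_on (coord_expr A c F) (slit_domain c)) \<and>
     (\<forall>c\<in>A. \<forall>z\<in>slit_domain c. rank (metric_tensor (coord_expr A c F) z) = CARD('n))"

definition berwald_space ::
    "('m::{t2_space, second_countable_topology}, 'n::finite) chart set \<Rightarrow>
     ('m \<times> ('m, 'n) tangent_vector \<Rightarrow> real) \<Rightarrow> bool" where
  "berwald_space A F \<longleftrightarrow> finsler_space A F \<and>
     (\<forall>c\<in>A. \<forall>z\<in>slit_domain c. \<forall>h i j k. berwald_curvature (coord_expr A c F) h i j k z = 0)"

definition landsberg_space ::
    "('m::{t2_space, second_countable_topology}, 'n::finite) chart set \<Rightarrow>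
     ('m \<times> ('m, 'n) tangent_vector \<Rightarrow> real) \<Rightarrow> bool" where
  "landsberg_space A F \<longleftrightarrow> finsler_space A F \<and>
     (\<forall>c\<in>A. \<forall>z\<in>slit_domain c. \<forall>i j k. landsberg_curvature (coord_expr A c F) i j k z = 0)"

section \<open>Parallel 1-forms\<close>

text \<open>A 1-form is a function on the tangent bundle of the form \<open>\<beta>(x, y) = b\<^sub>i(x) y\<^sup>i\<close>.\<close>

definition form_coeff ::
    "('m, 'n::finite) chart set \<Rightarrow> ('m, 'n) chart \<Rightarrow>
     ('m \<times> ('m, 'n) tangent_vector \<Rightarrow> real) \<Rightarrow> 'n \<Rightarrow> real ^ 'n \<Rightarrow> real" where
  "form_coeff A c \<beta> i x = coord_expr A c \<beta> (x, axis i 1)"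

definition one_form ::
    "('m, 'n::finite) chart set \<Rightarrow> ('m \<times> ('m, 'n) tangent_vector \<Rightarrow> real) \<Rightarrow> bool" where
  "one_form A \<beta> \<longleftrightarrow> (\<forall>c\<in>A.
     (\<forall>i. smooth_on (form_coeff A c \<beta> i) (snd c ` fst c)) \<and>
     (\<forall>x\<in>snd c ` fst c. \<forall>y. coord_expr A c \<beta> (x, y) = (\<Sum>i\<in>UNIV. form_coeff A c \<beta> i x * y $ i)))"

text \<open>
  For connected manifolds this says that \<open>\<beta>\<close> is not the zero form. In general the zero form
  has to be excluded on each connected component separately.
\<close>

definition nonzero_form ::
    "('m::topological_space, 'n::finite) chart set \<Rightarrow>
     ('m \<times> ('m, 'n) tangent_vector \<Rightarrow> real) \<Rightarrow> bool" where
  "nonzero_form A \<beta> \<longleftrightarrow>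
     (\<forall>C\<in>components (carrier A). \<exists>p\<in>C. \<exists>v\<in>tangent_space A p. \<beta> (p, v) \<noteq> 0)"

definition parallel_form ::
    "('m::topological_space, 'n::finite) chart set \<Rightarrow>
     ('m \<times> ('m, 'n) tangent_vector \<Rightarrow> real) \<Rightarrow> ('m \<times> ('m, 'n) tangent_vector \<Rightarrow> real) \<Rightarrow> bool" where
  "parallel_form A F \<beta> \<longleftrightarrow> one_form A \<beta> \<and>
     (\<forall>c\<in>A. \<forall>(x, y)\<in>slit_domain c. \<forall>i j.
        frechet_derivative (form_coeff A c \<beta> i) (at x) (axis j 1)
        - (\<Sum>h\<in>UNIV. berwald_connection (coord_expr A c F) h i j (x, y) * form_coeff A c \<beta> h x) = 0)"

end

theory Submission
  imports Defs
begin

text \<open>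
  Work in one chart, write \<open>b\<^sub>h\<close> for the coefficients of the parallel form \<open>\<beta>\<close>, and fix a
  base point \<open>x\<close>. As \<open>G\<^sup>h\<^sub>i\<^sub>j b\<^sub>h = \<partial>\<^sub>j b\<^sub>i\<close> depends on \<open>x\<close> only, its derivative in the fibre
  direction gives \<open>G\<^sup>h\<^sub>i\<^sub>j\<^sub>k b\<^sub>h = 0\<close> (\<open>berwald_curvature_annihilates_parallel\<close>), while
  the vanishing of the Landsberg curvature and \<open>F > 0\<close> give \<open>G\<^sup>h\<^sub>i\<^sub>j\<^sub>k F\<^sub>h = 0\<close>, where
  \<open>F\<^sub>h\<close> are the fibre derivatives of \<open>F\<close>. In dimension 2 these two linear equations force
  \<open>G\<^sup>h\<^sub>i\<^sub>j\<^sub>k = 0\<close> wherever the determinant \<open>\<phi> = b\<^sub>1 F\<^sub>2 - b\<^sub>2 F\<^sub>1\<close> is nonzero.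

  If \<open>b\<close> does not vanish at \<open>x\<close>, then \<open>\<phi>\<close> vanishes on no open piece of the fibre:
  \<open>\<phi>\<close> is the fibre derivative of \<open>F\<close> along \<open>w = (- b\<^sub>2, b\<^sub>1)\<close>, hence
  \<open>g\<^sub>i\<^sub>j w\<^sup>j\<close> is the derivative of \<open>F \<phi>\<close> by \<open>y\<^sup>i\<close>, and \<open>\<phi> = 0\<close> on an open piece would make
  \<open>g\<close> degenerate (\<open>fibre_derivative_not_locally_0\<close>). So \<open>G\<^sup>h\<^sub>i\<^sub>j\<^sub>k\<close> vanishes on a dense
  subset of the fibre, and being continuous it vanishes on the whole fibre
  (\<open>landsberg_surface_with_parallel_form_at\<close>). The continuity, and the existence of the
  derivatives above, rest on the smoothness of the spray coefficients, where the inverse of the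
  metric is controlled by Cramer's rule.

  It remains to see that \<open>b\<close> has no zeros (\<open>parallel_form_no_zeros\<close>). For a fixed
  \<open>y\<close>, the equations \<open>\<partial>\<^sub>j b\<^sub>i = G\<^sup>h\<^sub>i\<^sub>j b\<^sub>h\<close> form a linear system of total differential
  equations in \<open>x\<close> with continuous coefficients, so a solution that vanishes at a point vanishes
  near it (\<open>open_zero_set_total_differential_system\<close>). The points where \<open>\<beta>\<close> is zero and
  those where it is not thus form two open sets, and by connectedness a component of the manifold
  that meets the second lies in it.
\<close>

section \<open>Smooth functions\<close>

lemma C_k_on_cong:
  assumes "open S" "\<And>x. x \<in> S \<Longrightarrow> f x = g x" "C_k_on k f S"
  shows "C_k_on k g S"
  using assms(2,3)
proof (induction k arbitrary: f g)
  case 0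
  then show ?case
    by (metis C_k_on.simps(1) continuous_on_cong)
next
  case (Suc k)
  have df: "(f has_derivative frechet_derivative f (at x)) (at x)" if "x \<in> S" for x
    using Suc.prems(2) that frechet_derivative_works by auto
  have dg: "(g has_derivative frechet_derivative f (at x)) (at x)" if "x \<in> S" for x
    using has_derivative_transform_within_open[OF df[OF that] assms(1) that] Suc.prems(1) by auto
  have "frechet_derivative f (at x) v = frechet_derivative g (at x) v" if "x \<in> S" for x v
    using frechet_derivative_at[OF dg[OF that]] by simp
  then have "C_k_on k (\<lambda>x. frechet_derivative g (at x) v) S" for v
    using Suc.IH[of "\<lambda>x. frechet_derivative f (at x) v" "\<lambda>x. frechet_derivative g (at x) v"]
      Suc.prems(2) by auto
  then show ?case
    using dg unfolding C_k_on.simps differentiable_def by blast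
qed

lemma smooth_on_cong:
  assumes "open S" "\<And>x. x \<in> S \<Longrightarrow> f x = g x" "smooth_on f S"
  shows "smooth_on g S"
  using C_k_on_cong[OF assms(1), where f = f and g = g] assms(2,3)
  unfolding smooth_on_def by blast

lemma C_k_on_subset: "C_k_on k f S \<Longrightarrow> T \<subseteq> S \<Longrightarrow> C_k_on k f T"
  by (induction k arbitrary: f) (auto intro: continuous_on_subset)

lemma smooth_on_subset: "smooth_on f S \<Longrightarrow> T \<subseteq> S \<Longrightarrow> smooth_on f T"
  unfolding smooth_on_def using C_k_on_subset by blast

lemma C_k_on_Suc_imp: "C_k_on (Suc k) f S \<Longrightarrow> C_k_on k f S"
proof (induction k arbitrary: f)
  case 0
  then show ?case
    by (auto intro!: continuous_at_imp_continuous_on differentiable_imp_continuous_within)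
qed auto

lemma smooth_on_imp_continuous_on: "smooth_on f S \<Longrightarrow> continuous_on S f"
  unfolding smooth_on_def by (metis C_k_on.simps(1))

lemma smooth_on_imp_has_derivative:
  assumes "smooth_on f S" "x \<in> S"
  shows "(f has_derivative frechet_derivative f (at x)) (at x)"
proof -
  have "C_k_on (Suc 0) f S"
    using assms(1) unfolding smooth_on_def by blast
  then show ?thesis
    using assms(2) frechet_derivative_works by auto
qed

lemma smooth_on_frechet_derivative:
  "smooth_on f S \<Longrightarrow> smooth_on (\<lambda>x. frechet_derivative f (at x) v) S"
  unfolding smooth_on_def by (metis C_k_on.simps(2))

lemma C_k_on_const: "C_k_on k (\<lambda>x. a) S"
  by (induction k arbitrary: a) auto

lemma smooth_on_const: "smooth_on (\<lambda>x. a) S"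
  unfolding smooth_on_def by (simp add: C_k_on_const)

lemma smooth_on_bounded_linear:
  assumes "bounded_linear f"
  shows "smooth_on f S"
  unfolding smooth_on_def
proof
  fix k
  have d: "(f has_derivative f) (at x)" for x
    by (rule bounded_linear_imp_has_derivative[OF assms])
  then have "frechet_derivative f (at x) = f" for x
    using frechet_derivative_at by metis
  then show "C_k_on k f S"
    using d bounded_linear.continuous_on[OF assms continuous_on_id]
    by (cases k) (auto simp: C_k_on_const differentiable_def)
qed

lemma C_k_on_add:
  assumes "open S" "C_k_on k f S" "C_k_on k g S"
  shows "C_k_on k (\<lambda>x. f x + g x) S"
  using assms(2,3)
proof (induction k arbitrary: f g)
  case 0
  then show ?case by (auto intro: continuous_intros)
next
  case (Suc k)
  have d: "((\<lambda>x. f x + g x) has_derivative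
      (\<lambda>v. frechet_derivative f (at x) v + frechet_derivative g (at x) v)) (at x)" if "x \<in> S" for x
    using Suc.prems that by (intro has_derivative_add) (auto simp: frechet_derivative_works)
  have "C_k_on k (\<lambda>x. frechet_derivative (\<lambda>x. f x + g x) (at x) v) S" for v
  proof (rule C_k_on_cong[OF assms(1)])
    show "C_k_on k (\<lambda>x. frechet_derivative f (at x) v + frechet_derivative g (at x) v) S"
      using Suc by auto
  qed (simp add: frechet_derivative_at[OF d, symmetric])
  then show ?case
    using d unfolding C_k_on.simps differentiable_def by blast
qed

lemma C_k_on_mult:
  fixes f g :: "'a::real_normed_vector \<Rightarrow> real"
  assumes "open S" "C_k_on k f S" "C_k_on k g S"
  shows "C_k_on k (\<lambda>x. f x * g x) S"
  using assms(2,3)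
proof (induction k arbitrary: f g)
  case 0
  then show ?case by (auto intro: continuous_intros)
next
  case (Suc k)
  have d: "((\<lambda>x. f x * g x) has_derivative
      (\<lambda>v. f x * frechet_derivative g (at x) v + frechet_derivative f (at x) v * g x)) (at x)"
    if "x \<in> S" for x
    using Suc.prems that by (intro has_derivative_mult) (auto simp: frechet_derivative_works)
  have "C_k_on k (\<lambda>x. frechet_derivative (\<lambda>x. f x * g x) (at x) v) S" for v
  proof (rule C_k_on_cong[OF assms(1)])
    show "C_k_on k (\<lambda>x. f x * frechet_derivative g (at x) v + frechet_derivative f (at x) v * g x) S"
      using Suc.prems Suc.prems[THEN C_k_on_Suc_imp]
      by (intro C_k_on_add[OF assms(1)] Suc.IH) auto
  qed (simp add: frechet_derivative_at[OF d, symmetric])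
  then show ?case
    using d unfolding C_k_on.simps differentiable_def by blast
qed

lemma C_k_on_inverse:
  fixes f :: "'a::real_normed_vector \<Rightarrow> real"
  assumes "open S" "\<And>x. x \<in> S \<Longrightarrow> f x \<noteq> 0" "C_k_on k f S"
  shows "C_k_on k (\<lambda>x. inverse (f x)) S"
  using assms(3)
proof (induction k)
  case 0
  then show ?case using assms(2) by (auto intro: continuous_intros)
next
  case (Suc k)
  have d: "((\<lambda>x. inverse (f x)) has_derivative
      (\<lambda>v. - (inverse (f x) * frechet_derivative f (at x) v * inverse (f x)))) (at x)"
    if "x \<in> S" for x
    using Suc.prems that assms(2)
    by (intro Deriv.has_derivative_inverse) (auto simp: frechet_derivative_works)
  have "C_k_on k (\<lambda>x. frechet_derivative (\<lambda>x. inverse (f x)) (at x) v) S" for v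
  proof (rule C_k_on_cong[OF assms(1)])
    show "C_k_on k
        (\<lambda>x. (- 1) * (inverse (f x) * frechet_derivative f (at x) v * inverse (f x))) S"
      using Suc.prems Suc.IH[OF C_k_on_Suc_imp[OF Suc.prems]]
      by (intro C_k_on_mult[OF assms(1)] C_k_on_const) auto
  qed (simp add: frechet_derivative_at[OF d, symmetric])
  then show ?case
    using d unfolding C_k_on.simps differentiable_def by blast
qed

lemma smooth_on_add:
  "open S \<Longrightarrow> smooth_on f S \<Longrightarrow> smooth_on g S \<Longrightarrow> smooth_on (\<lambda>x. f x + g x) S"
  unfolding smooth_on_def by (simp add: C_k_on_add)

lemma smooth_on_mult:
  fixes f g :: "'a::real_normed_vector \<Rightarrow> real"
  shows "open S \<Longrightarrow> smooth_on f S \<Longrightarrow> smooth_on g S \<Longrightarrow> smooth_on (\<lambda>x. f x * g x) S"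
  unfolding smooth_on_def by (simp add: C_k_on_mult)

lemma smooth_on_diff:
  fixes f g :: "'a::real_normed_vector \<Rightarrow> real"
  assumes "open S" "smooth_on f S" "smooth_on g S"
  shows "smooth_on (\<lambda>x. f x - g x) S"
  using smooth_on_add[OF assms(1,2) smooth_on_mult[OF assms(1) smooth_on_const[of "- 1"] assms(3)]]
  by simp

lemma smooth_on_divide:
  fixes f g :: "'a::real_normed_vector \<Rightarrow> real"
  assumes "open S" "smooth_on f S" "smooth_on g S" "\<And>x. x \<in> S \<Longrightarrow> g x \<noteq> 0"
  shows "smooth_on (\<lambda>x. f x / g x) S"
  using assms unfolding smooth_on_def divide_inverse
  by (simp add: C_k_on_mult C_k_on_inverse)

lemma smooth_on_sum:
  assumes "open S" "\<And>i. i \<in> I \<Longrightarrow> smooth_on (f i) S"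
  shows "smooth_on (\<lambda>x. \<Sum>i\<in>I. f i x) S"
  using assms(2)
  by (induction I rule: infinite_finite_induct)
    (auto intro: smooth_on_const smooth_on_add[OF assms(1)])

lemma smooth_on_prod:
  fixes f :: "'i \<Rightarrow> 'a::real_normed_vector \<Rightarrow> real"
  assumes "open S" "\<And>i. i \<in> I \<Longrightarrow> smooth_on (f i) S"
  shows "smooth_on (\<lambda>x. \<Prod>i\<in>I. f i x) S"
  using assms(2)
  by (induction I rule: infinite_finite_induct)
    (auto intro: smooth_on_const smooth_on_mult[OF assms(1)])

lemma smooth_on_det:
  fixes M :: "'a::real_normed_vector \<Rightarrow> real ^ 'n ^ 'n"
  assumes "open S" "\<And>i j. smooth_on (\<lambda>z. M z $ i $ j) S"
  shows "smooth_on (\<lambda>z. det (M z)) S"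
  unfolding det_def
  by (intro smooth_on_sum smooth_on_mult smooth_on_prod smooth_on_const assms)

text \<open>By Cramer's rule the entries of the inverse are quotients of determinants.\<close>

lemma smooth_on_matrix_inv:
  fixes M :: "'a::real_normed_vector \<Rightarrow> real ^ 'n ^ 'n"
  assumes S: "open S" and M: "\<And>i j. smooth_on (\<lambda>z. M z $ i $ j) S"
    and inv: "\<And>z. z \<in> S \<Longrightarrow> det (M z) \<noteq> 0"
  shows "smooth_on (\<lambda>z. matrix_inv (M z) $ k $ l) S"
proof (rule smooth_on_cong[OF S])
  let ?N = "\<lambda>z. (\<chi> i j. if j = k then axis l 1 $ i else M z $ i $ j) :: real ^ 'n ^ 'n"
  show "smooth_on (\<lambda>z. det (?N z) / det (M z)) S"
  proof (intro smooth_on_divide smooth_on_det S M inv)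
    show "smooth_on (\<lambda>z. ?N z $ i $ j) S" for i j
      by (cases "j = k") (auto simp: M smooth_on_const)
  qed
  show "det (?N z) / det (M z) = matrix_inv (M z) $ k $ l" if "z \<in> S" for z
  proof -
    have d: "det (M z) \<noteq> 0" by (rule inv[OF that])
    then have "\<exists>N. M z ** N = mat 1 \<and> N ** M z = mat 1"
      by (simp flip: invertible_det_nz add: invertible_def)
    then have "M z ** matrix_inv (M z) = mat 1"
      unfolding matrix_inv_def by (rule someI2_ex) blast
    then have "M z *v (matrix_inv (M z) *v axis l 1) = axis l 1"
      by (simp add: matrix_vector_mul_assoc)
    then have "matrix_inv (M z) *v axis l 1 =
        (\<chi> k. det (\<chi> i j. if j = k then axis l 1 $ i else M z $ i $ j) / det (M z))"
      using cramer[OF d] by blast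
    then show ?thesis
      by (simp add: matrix_vector_mult_basis column_def vec_eq_iff)
  qed
qed

lemma smooth_on_pdx: "smooth_on f S \<Longrightarrow> smooth_on (pdx i f) S"
  unfolding pdx_def[abs_def] by (rule smooth_on_frechet_derivative)

lemma smooth_on_pdy: "smooth_on f S \<Longrightarrow> smooth_on (pdy i f) S"
  unfolding pdy_def[abs_def] by (rule smooth_on_frechet_derivative)

text \<open>
  Constancy is only asked for along the line through \<open>z\<close> in the direction \<open>v\<close>, because the
  functions below are constant on pieces of a single fibre and not on open sets.
\<close>

lemma directional_derivative_eq_0:
  fixes f :: "'a::real_normed_vector \<Rightarrow> real"
  assumes "f differentiable (at z)" "e > 0" "\<And>t. \<bar>t\<bar> < e \<Longrightarrow> f (z + t *\<^sub>R v) = f z"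
  shows "frechet_derivative f (at z) v = 0"
proof -
  have f: "(f has_derivative frechet_derivative f (at z)) (at (z + 0 *\<^sub>R v))"
    using assms(1) by (simp add: frechet_derivative_works)
  have "((\<lambda>t::real. z + t *\<^sub>R v) has_derivative (\<lambda>t. t *\<^sub>R v)) (at 0)"
    by (auto intro!: derivative_eq_intros)
  from has_derivative_compose[OF this f]
  have *: "((\<lambda>t. f (z + t *\<^sub>R v)) has_derivative (\<lambda>t. frechet_derivative f (at z) (t *\<^sub>R v))) (at 0)" .
  have "((\<lambda>t::real. f z) has_derivative (\<lambda>t. frechet_derivative f (at z) (t *\<^sub>R v))) (at 0)"
    by (rule has_derivative_transform_within_open[OF *, of "ball 0 e"])
       (use assms in \<open>auto\<close>)
  moreover have "((\<lambda>t::real. f z) has_derivative (\<lambda>t. 0)) (at 0)"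
    by simp
  ultimately have "(\<lambda>t. frechet_derivative f (at z) (t *\<^sub>R v)) = (\<lambda>t::real. 0)"
    by (rule has_derivative_unique)
  from fun_cong[OF this, of 1] show ?thesis by simp
qed

section \<open>The geometric objects of a Finsler function in one chart\<close>

lemma det_nonzero_if_full_rank:
  fixes M :: "real ^ 'n ^ 'n"
  assumes "rank M = CARD('n)"
  shows "det M \<noteq> 0"
  using assms by (simp add: det_eq_0_rank)

lemma smooth_on_spray_coeff:
  fixes f :: "(real ^ 'n) \<times> (real ^ 'n) \<Rightarrow> real"
  assumes S: "open S" and f: "smooth_on f S"
    and rank: "\<And>z. z \<in> S \<Longrightarrow> rank (metric_tensor f z) = CARD('n)"
  shows "smooth_on (spray_coeff f i) S"
proof -
  have sq: "smooth_on (\<lambda>w. (f w)\<^sup>2) S"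
    unfolding power2_eq_square by (intro smooth_on_mult S f)
  have "smooth_on (\<lambda>z. metric_tensor f z $ i $ j) S" for i j
    unfolding metric_tensor_def
    by (simp, intro smooth_on_pdy smooth_on_mult[OF S smooth_on_const sq, of "1/2", simplified])
  moreover have "smooth_on (\<lambda>z::(real ^ 'n) \<times> (real ^ 'n). snd z $ k) S" for k
    by (intro smooth_on_bounded_linear bounded_linear_compose[OF bounded_linear_vec_nth bounded_linear_snd])
  ultimately show ?thesis
    unfolding spray_coeff_def[abs_def]
    by (intro smooth_on_mult smooth_on_sum smooth_on_diff smooth_on_matrix_inv smooth_on_const
        smooth_on_pdx smooth_on_pdy S sq det_nonzero_if_full_rank rank)
qed

lemma smooth_on_berwald_connection:
  fixes f :: "(real ^ 'n) \<times> (real ^ 'n) \<Rightarrow> real"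
  assumes "open S" "smooth_on f S" "\<And>z. z \<in> S \<Longrightarrow> rank (metric_tensor f z) = CARD('n)"
  shows "smooth_on (berwald_connection f h i j) S"
  unfolding berwald_connection_def by (intro smooth_on_pdy smooth_on_spray_coeff assms)

lemma smooth_on_berwald_curvature:
  fixes f :: "(real ^ 'n) \<times> (real ^ 'n) \<Rightarrow> real"
  assumes "open S" "smooth_on f S" "\<And>z. z \<in> S \<Longrightarrow> rank (metric_tensor f z) = CARD('n)"
  shows "smooth_on (berwald_curvature f h i j k) S"
  unfolding berwald_curvature_def by (intro smooth_on_pdy smooth_on_berwald_connection assms)

lemma open_fibre_nbhd:
  fixes x y :: "real ^ 'n"
  assumes "open S" "(x, y) \<in> S"
  obtains e where "e > 0" "\<And>w. norm w < e \<Longrightarrow> (x, y + w) \<in> S"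
proof -
  obtain e where "e > 0" and e: "ball (x, y) e \<subseteq> S"
    using assms open_contains_ball by blast
  show thesis
  proof (rule that[OF \<open>e > 0\<close>])
    show "(x, y + w) \<in> S" if "norm w < e" for w
      using e that by (auto simp: dist_Pair_Pair dist_norm)
  qed
qed

lemma pdy_eq_0:
  fixes f :: "(real ^ 'n) \<times> (real ^ 'n) \<Rightarrow> real"
  assumes S: "open S" "(x, y) \<in> S" and f: "f differentiable (at (x, y))"
    and const: "\<And>w. (x, w) \<in> S \<Longrightarrow> f (x, w) = a"
  shows "pdy k f (x, y) = 0"
proof -
  obtain e where "e > 0" and e: "\<And>w. norm w < e \<Longrightarrow> (x, y + w) \<in> S"
    using open_fibre_nbhd[OF S] by blast
  have "f ((x, y) + t *\<^sub>R (0, axis k 1)) = f (x, y)" if "\<bar>t\<bar> < e" for t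
    using const[OF S(2)] const[OF e[of "t *\<^sub>R axis k 1"]] that by simp
  then show ?thesis
    unfolding pdy_def by (rule directional_derivative_eq_0[OF f \<open>e > 0\<close>])
qed

lemma pdy_sum:
  fixes f :: "'i \<Rightarrow> (real ^ 'n) \<times> (real ^ 'n) \<Rightarrow> real"
  assumes "\<And>h. h \<in> I \<Longrightarrow> f h differentiable (at z)"
  shows "(\<lambda>w. \<Sum>h\<in>I. f h w * a h) differentiable (at z)"
    and "pdy k (\<lambda>w. \<Sum>h\<in>I. f h w * a h) z = (\<Sum>h\<in>I. pdy k (f h) z * a h)"
proof -
  have *: "((\<lambda>w. \<Sum>h\<in>I. f h w * a h) has_derivative
      (\<lambda>v. \<Sum>h\<in>I. frechet_derivative (f h) (at z) v * a h)) (at z)"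
    using assms by (intro has_derivative_sum has_derivative_mult_left)
      (auto simp: frechet_derivative_works)
  then show "(\<lambda>w. \<Sum>h\<in>I. f h w * a h) differentiable (at z)"
    unfolding differentiable_def by blast
  show "pdy k (\<lambda>w. \<Sum>h\<in>I. f h w * a h) z = (\<Sum>h\<in>I. pdy k (f h) z * a h)"
    unfolding pdy_def frechet_derivative_at[OF *, symmetric] ..
qed

text \<open>
  Here \<open>a\<close> is the value at \<open>x\<close> of the coefficients of a parallel form, and \<open>d\<close> the partial
  derivative \<open>\<partial>\<^sub>j b\<^sub>i\<close>. Both are constant along the fibre, so that \<open>G\<^sup>h\<^sub>i\<^sub>j b\<^sub>h = \<partial>\<^sub>j b\<^sub>i\<close>
  can be differentiated by \<open>y\<^sup>k\<close>.
\<close>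

lemma berwald_curvature_annihilates_parallel:
  fixes f :: "(real ^ 'n) \<times> (real ^ 'n) \<Rightarrow> real" and a :: "'n \<Rightarrow> real"
  assumes S: "open S" "(x, y) \<in> S" and f: "smooth_on f S"
    and rank: "\<And>z. z \<in> S \<Longrightarrow> rank (metric_tensor f z) = CARD('n)"
    and par: "\<And>w. (x, w) \<in> S \<Longrightarrow> (\<Sum>h\<in>UNIV. berwald_connection f h i j (x, w) * a h) = d"
  shows "(\<Sum>h\<in>UNIV. berwald_curvature f h i j k (x, y) * a h) = 0"
proof -
  have dif: "berwald_connection f h i j differentiable (at (x, y))" for h
    using smooth_on_imp_has_derivative[OF smooth_on_berwald_connection[OF S(1) f rank] S(2)]
    unfolding differentiable_def by blast
  have "pdy k (\<lambda>z. \<Sum>h\<in>UNIV. berwald_connection f h i j z * a h) (x, y) = 0"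
    by (rule pdy_eq_0[OF S pdy_sum(1)[OF dif] par])
  then show ?thesis
    unfolding berwald_curvature_def by (simp add: pdy_sum(2)[OF dif])
qed

text \<open>
  If the fibre derivative of \<open>f\<close> along the constant vector \<open>w\<close> is 0 on an open piece of the fibre,
  then so is that of \<open>f\<^sup>2 / 2\<close>. Differentiating once more, by \<open>y\<^sup>i\<close>, gives
  \<open>g\<^sub>i\<^sub>j w\<^sup>j = 0\<close>, against the nondegeneracy of the metric. As \<open>S\<close> is an arbitrary open set around
  \<open>(x, y)\<close>, the lemma provides points with nonzero derivative arbitrarily close to it.
\<close>

lemma fibre_derivative_not_locally_0:
  fixes f :: "(real ^ 'n) \<times> (real ^ 'n) \<Rightarrow> real" and w :: "real ^ 'n"
  assumes S: "open S" "(x, y) \<in> S" and f: "smooth_on f S"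
    and rank: "rank (metric_tensor f (x, y)) = CARD('n)"
    and "w \<noteq> 0"
  shows "\<exists>u. (x, u) \<in> S \<and> (\<Sum>j\<in>UNIV. pdy j f (x, u) * w $ j) \<noteq> 0"
proof (rule ccontr)
  assume "\<not> ?thesis"
  then have zero: "(\<Sum>j\<in>UNIV. pdy j f (x, u) * w $ j) = 0" if "(x, u) \<in> S" for u
    using that by blast
  let ?E = "\<lambda>w. 1/2 * (f w)\<^sup>2"
  have E: "smooth_on ?E S"
    unfolding power2_eq_square by (intro smooth_on_mult smooth_on_const S f)
  have pdyE: "pdy j ?E z = f z * pdy j f z" if "z \<in> S" for j z
  proof -
    have "(?E has_derivative (\<lambda>v. f z * frechet_derivative f (at z) v)) (at z)"
      using smooth_on_imp_has_derivative[OF f that] by (auto intro!: derivative_eq_intros)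
    from frechet_derivative_at[OF this, symmetric] show ?thesis
      by (simp add: pdy_def)
  qed
  have dif: "pdy j ?E differentiable (at (x, y))" for j
    using smooth_on_imp_has_derivative[OF smooth_on_pdy[OF E] S(2)]
    unfolding differentiable_def by blast
  have "(\<Sum>j\<in>UNIV. pdy j ?E (x, u) * w $ j) = 0" if "(x, u) \<in> S" for u
    using zero[OF that] by (simp only: pdyE[OF that] mult.assoc mult_zero_right flip: sum_distrib_left)
  then have "pdy i (\<lambda>z. \<Sum>j\<in>UNIV. pdy j ?E z * w $ j) (x, y) = 0" for i
    by (intro pdy_eq_0[OF S pdy_sum(1)[OF dif]])
  then have "(\<Sum>j\<in>UNIV. pdy i (pdy j ?E) (x, y) * w $ j) = 0" for i
    by (simp only: pdy_sum(2)[OF dif])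
  then have "metric_tensor f (x, y) *v w = 0"
    by (simp add: metric_tensor_def matrix_vector_mult_def vec_eq_iff)
  moreover have "inj ((*v) (metric_tensor f (x, y)))"
    using rank by (simp add: full_rank_injective)
  ultimately have "w = 0"
    by (metis injD matrix_vector_mult_0_right)
  with \<open>w \<noteq> 0\<close> show False ..
qed

text \<open>
  If some \<open>G\<^sup>h\<^sub>i\<^sub>j\<^sub>k\<close> were nonzero at \<open>(x, y)\<close>, it would be so on a neighbourhood. That
  neighbourhood contains a point over the same \<open>x\<close> at which the coefficient vector and the fibre
  differential of \<open>f\<close> are linearly independent, and both annihilate the curvature there.
\<close>

lemma landsberg_surface_with_parallel_form_at:
  fixes f :: "(real ^ 2) \<times> (real ^ 2) \<Rightarrow> real" and a :: "2 \<Rightarrow> real"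
  assumes S: "open S" "(x, y) \<in> S" and f: "smooth_on f S"
    and pos: "\<And>z. z \<in> S \<Longrightarrow> f z > 0"
    and rank: "\<And>z. z \<in> S \<Longrightarrow> rank (metric_tensor f z) = CARD(2)"
    and lands: "\<And>z. z \<in> S \<Longrightarrow> landsberg_curvature f i j k z = 0"
    and par: "\<And>w. (x, w) \<in> S \<Longrightarrow> (\<Sum>h\<in>UNIV. berwald_connection f h i j (x, w) * a h) = d"
    and nz: "a m \<noteq> 0"
  shows "berwald_curvature f h i j k (x, y) = 0"
proof (rule ccontr)
  let ?B = "\<lambda>h. berwald_curvature f h i j k"
  assume ne: "?B h (x, y) \<noteq> 0"
  have cont: "continuous_on S (?B h)"
    by (intro smooth_on_imp_continuous_on smooth_on_berwald_curvature S f rank)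
  let ?T = "S \<inter> ?B h -` (- {0})"
  have "open ?T"
    using continuous_open_preimage[OF cont S(1), of "- {0}"] by auto
  have "(x, y) \<in> ?T"
    using S(2) ne by simp
  \<comment> \<open>The kernel of \<open>a\<close> is spanned by \<open>w\<close>, and the derivative of \<open>f\<close> along \<open>w\<close> is the
    determinant of the two linear equations for the curvature.\<close>
  define w :: "real ^ 2" where "w = vector [- a 2, a 1]"
  have "w \<noteq> 0"
    using nz exhaust_2[of m] by (auto simp: w_def vec_eq_iff forall_2)
  have "smooth_on f ?T"
    using smooth_on_subset[OF f] by blast
  then obtain u where u: "(x, u) \<in> ?T" "(\<Sum>j\<in>UNIV. pdy j f (x, u) * w $ j) \<noteq> 0"
    using fibre_derivative_not_locally_0[OF \<open>open ?T\<close> \<open>(x, y) \<in> ?T\<close> _ rank[OF S(2)] \<open>w \<noteq> 0\<close>] by blast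
  then have uS: "(x, u) \<in> S" and Bu: "?B h (x, u) \<noteq> 0"
    by auto
  have 1: "?B 1 (x, u) * a 1 + ?B 2 (x, u) * a 2 = 0"
    using berwald_curvature_annihilates_parallel[OF S(1) uS f rank par] by (simp add: sum_2)
  have 2: "?B 1 (x, u) * pdy 1 f (x, u) + ?B 2 (x, u) * pdy 2 f (x, u) = 0"
    using lands[OF uS] pos[OF uS] by (simp add: landsberg_curvature_def sum_2)
  have det: "a 1 * pdy 2 f (x, u) - a 2 * pdy 1 f (x, u) \<noteq> 0"
    using u(2) by (simp add: w_def sum_2 algebra_simps)
  have "?B 1 (x, u) * (a 1 * pdy 2 f (x, u) - a 2 * pdy 1 f (x, u)) = 0"
       "?B 2 (x, u) * (a 1 * pdy 2 f (x, u) - a 2 * pdy 1 f (x, u)) = 0"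
    using 1 2 by algebra+
  with det have "?B 1 (x, u) = 0" "?B 2 (x, u) = 0"
    by auto
  with Bu show False
    using exhaust_2[of h] by auto
qed

section \<open>Zeros of solutions of linear total differential systems\<close>

text \<open>
  Let \<open>m\<close> be the sum of the absolute values of the \<open>a i\<close>, and \<open>x1\<close> a point of a small closed ball
  of radius \<open>r\<close> around \<open>x0\<close> at which \<open>m\<close> is maximal. The equations bound the derivatives of the
  \<open>a i\<close> on the ball by a constant \<open>K\<close> times \<open>m x1\<close>. By the mean value inequality
  \<open>m x1 \<le> n K r m x1\<close> with \<open>n\<close> the dimension, so \<open>m x1 = 0\<close> once \<open>n K r < 1\<close>.
\<close>

lemma open_zero_set_total_differential_system:
  fixes a :: "'n \<Rightarrow> real ^ 'n \<Rightarrow> real" and \<Gamma> :: "'n \<Rightarrow> 'n \<Rightarrow> 'n \<Rightarrow> real ^ 'n \<Rightarrow> real"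
  assumes X: "open X" "x0 \<in> X"
    and a: "\<And>i x. x \<in> X \<Longrightarrow> a i differentiable (at x)"
    and \<Gamma>: "\<And>h i j. continuous_on X (\<Gamma> h i j)"
    and eq: "\<And>i j x. x \<in> X \<Longrightarrow>
      frechet_derivative (a i) (at x) (axis j 1) = (\<Sum>h\<in>UNIV. \<Gamma> h i j x * a h x)"
    and zero: "\<And>i. a i x0 = 0"
  shows "\<exists>r>0. \<forall>x\<in>ball x0 r. \<forall>i. a i x = 0"
proof -
  define \<kappa> where "\<kappa> x = (\<Sum>i\<in>UNIV. \<Sum>j\<in>UNIV. \<Sum>h\<in>UNIV. \<bar>\<Gamma> h i j x\<bar>)" for x
  define m where "m x = (\<Sum>i\<in>UNIV. \<bar>a i x\<bar>)" for x
  obtain R where R: "R > 0" "cball x0 R \<subseteq> X"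
    using X open_contains_cball by blast
  have cont_m: "continuous_on X m"
    unfolding m_def
    by (intro continuous_intros continuous_at_imp_continuous_on)
       (auto intro: differentiable_imp_continuous_within a)
  have "continuous_on (cball x0 R) \<kappa>"
    unfolding \<kappa>_def using \<Gamma> R(2) by (intro continuous_intros) (blast intro: continuous_on_subset)
  then obtain z where "\<forall>x\<in>cball x0 R. \<kappa> x \<le> \<kappa> z"
    using continuous_attains_sup[of "cball x0 R" \<kappa>] R(1) by auto
  then obtain K where K: "K > 0" "\<And>x. x \<in> cball x0 R \<Longrightarrow> \<kappa> x \<le> K"
    by (meson less_le_not_le linorder_le_less_linear not_less order.trans zero_less_one)
  define r where "r = min R (1 / (2 * K * CARD('n)))"
  have r: "r > 0" "r \<le> R"
    using R(1) K(1) by (auto simp: r_def)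
  have rK: "CARD('n) * (K * r) \<le> 1/2"
  proof -
    have "r \<le> 1 / (2 * K * CARD('n))" by (simp add: r_def)
    then show ?thesis using K(1) by (simp add: field_simps)
  qed
  let ?D = "cball x0 r"
  have D: "?D \<subseteq> X" "?D \<subseteq> cball x0 R"
    using R(2) r(2) by auto
  obtain x1 where x1: "x1 \<in> ?D" "\<And>x. x \<in> ?D \<Longrightarrow> m x \<le> m x1"
    using continuous_attains_sup[of ?D m] r(1) continuous_on_subset[OF cont_m D(1)] by auto
  have m0: "0 \<le> m x" for x
    unfolding m_def by (simp add: sum_nonneg)
  have a_le: "\<bar>a h x\<bar> \<le> m x" for h x
    unfolding m_def by (rule member_le_sum) auto
  have bound: "norm (frechet_derivative (a i) (at x) v) \<le> K * m x1 * norm v"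
    if "x \<in> ?D" for i x v
  proof -
    have lin: "linear (frechet_derivative (a i) (at x))"
      using a D(1) that by (meson has_derivative_linear frechet_derivative_works subsetD)
    have "frechet_derivative (a i) (at x) v =
        frechet_derivative (a i) (at x) (\<Sum>j\<in>UNIV. v $ j *\<^sub>R axis j 1)"
      by (simp only: basis_expansion flip: scalar_mult_eq_scaleR)
    also have "\<dots> = (\<Sum>j\<in>UNIV. v $ j * frechet_derivative (a i) (at x) (axis j 1))"
      by (simp add: linear_sum[OF lin] linear_scale[OF lin])
    also have "\<dots> = (\<Sum>j\<in>UNIV. \<Sum>h\<in>UNIV. v $ j * (\<Gamma> h i j x * a h x))"
      using eq D(1) that by (auto simp: sum_distrib_left)
    also have "\<bar>\<dots>\<bar> \<le> (\<Sum>j\<in>UNIV. \<Sum>h\<in>UNIV. norm v * (\<bar>\<Gamma> h i j x\<bar> * m x1))"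
      by (intro order.trans[OF sum_abs] sum_mono)
         (auto simp: abs_mult intro!: mult_mono component_le_norm_cart
           order.trans[OF a_le x1(2)[OF that]])
    also have "\<dots> = (\<Sum>j\<in>UNIV. \<Sum>h\<in>UNIV. \<bar>\<Gamma> h i j x\<bar>) * (m x1 * norm v)"
      by (simp add: sum_distrib_left sum_distrib_right mult_ac)
    also have "\<dots> \<le> \<kappa> x * (m x1 * norm v)"
      unfolding \<kappa>_def
      by (intro mult_right_mono member_le_sum[where f = "\<lambda>i. \<Sum>j\<in>UNIV. \<Sum>h\<in>UNIV. \<bar>\<Gamma> h i j x\<bar>"])
         (auto intro!: sum_nonneg mult_nonneg_nonneg m0)
    also have "\<dots> \<le> K * (m x1 * norm v)"
      using K(2) D(2) that m0 by (intro mult_right_mono) auto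
    finally show ?thesis by (simp add: mult.assoc)
  qed
  have "\<bar>a i x1\<bar> \<le> K * r * m x1" for i
  proof -
    have "norm (a i x1 - a i x0) \<le> K * m x1 * norm (x1 - x0)"
    proof (rule differentiable_bound)
      show "(a i has_derivative frechet_derivative (a i) (at x)) (at x within ?D)" if "x \<in> ?D" for x
        using a D(1) that frechet_derivative_works has_derivative_at_withinI by blast
      show "onorm (frechet_derivative (a i) (at x)) \<le> K * m x1" if "x \<in> ?D" for x
        by (rule onorm_le[OF bound[OF that]])
    qed (use x1 r in auto)
    also have "\<dots> \<le> K * m x1 * r"
      using x1(1) K(1) m0 by (intro mult_left_mono) (auto simp: dist_norm norm_minus_commute)
    finally show ?thesis by (simp add: zero mult_ac)
  qed
  then have "m x1 \<le> CARD('n) * (K * r * m x1)"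
    unfolding m_def[of x1] by (intro sum_bounded_above) auto
  also have "\<dots> \<le> 1/2 * m x1"
    using mult_right_mono[OF rK m0[of x1]] by (simp add: mult_ac)
  finally have "m x1 \<le> 0" by simp
  then have "a i x = 0" if "x \<in> ball x0 r" for x i
    using a_le[of i x] x1(2)[of x] that by auto
  then show ?thesis using r(1) by blast
qed

section \<open>Tangent vectors and their coordinates\<close>

lemma open_chart_image:
  assumes "is_chart c" "open U" "U \<subseteq> fst c"
  shows "open (snd c ` U)"
proof -
  have "openin (top_of_set (snd c ` fst c)) (snd c ` U)"
  proof (rule homeomorphism_imp_open_map)
    show "homeomorphism (fst c) (snd c ` fst c) (snd c) (inv_into (fst c) (snd c))"
      using assms(1) unfolding is_chart_def by blast
    show "openin (top_of_set (fst c)) U"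
      using assms by (simp add: is_chart_def openin_open_eq)
  qed
  then show ?thesis
    using assms(1) by (simp add: is_chart_def openin_open_eq)
qed

lemma chart_inv:
  assumes "is_chart c" "p \<in> fst c"
  shows "inv_into (fst c) (snd c) (snd c p) = p"
  using assms unfolding is_chart_def homeomorphism_def by blast

lemma chart_inj_on: "is_chart c \<Longrightarrow> inj_on (snd c) (fst c)"
  by (metis chart_inv inj_onI)

lemma has_derivative_transition:
  assumes A: "smooth_manifold A" and "c \<in> A" "d \<in> A" "p \<in> fst c" "p \<in> fst d"
  shows "(transition c d has_derivative frechet_derivative (transition c d) (at (snd c p)))
    (at (snd c p))"
proof (rule smooth_on_imp_has_derivative)
  show "smooth_on (transition c d) (snd c ` (fst c \<inter> fst d))"
    using assms unfolding smooth_manifold_def by blast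
qed (use assms in blast)

lemma frechet_derivative_transition_refl:
  assumes A: "smooth_manifold A" and c: "c \<in> A" "p \<in> fst c"
  shows "frechet_derivative (transition c c) (at (snd c p)) = (\<lambda>v. v)"
proof -
  have chart: "is_chart c" using A c unfolding smooth_manifold_def by blast
  have "((\<lambda>x. x) has_derivative (\<lambda>v. v)) (at (snd c p))" by simp
  then have "(transition c c has_derivative (\<lambda>v. v)) (at (snd c p))"
    by (rule has_derivative_transform_within_open[where s = "snd c ` fst c"])
       (use chart c in \<open>auto simp: transition_def chart_inv is_chart_def\<close>)
  from frechet_derivative_at[OF this] show ?thesis by simp
qed

text \<open>
  The cocycle rule for the Jacobians makes the family of pushed-forward components of a vector
  compatible, so every component vector in one chart comes from a tangent vector.
\<close>

lemma frechet_derivative_transition_trans: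
  assumes A: "smooth_manifold A" and c: "c \<in> A" "p \<in> fst c" and d: "d \<in> A" "p \<in> fst d"
    and e: "e \<in> A" "p \<in> fst e"
  shows "frechet_derivative (transition c e) (at (snd c p)) v =
    frechet_derivative (transition d e) (at (snd d p))
      (frechet_derivative (transition c d) (at (snd c p)) v)"
proof -
  have chart: "is_chart c" "is_chart d" "is_chart e"
    using A c d e unfolding smooth_manifold_def by blast+
  have p: "transition c d (snd c p) = snd d p"
    using chart c by (simp add: transition_def chart_inv)
  let ?U = "fst c \<inter> fst d \<inter> fst e"
  have "open ?U"
    using chart unfolding is_chart_def by auto
  have "((\<lambda>x. transition d e (transition c d x)) has_derivative
      (\<lambda>v. frechet_derivative (transition d e) (at (snd d p))
        (frechet_derivative (transition c d) (at (snd c p)) v))) (at (snd c p))"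
    by (rule has_derivative_compose[OF has_derivative_transition[OF A c(1) d(1) c(2) d(2)]])
       (use has_derivative_transition[OF A d(1) e(1) d(2) e(2)] p in simp)
  then have "(transition c e has_derivative
      (\<lambda>v. frechet_derivative (transition d e) (at (snd d p))
        (frechet_derivative (transition c d) (at (snd c p)) v))) (at (snd c p))"
  proof (rule has_derivative_transform_within_open[where s = "snd c ` ?U"])
    show "open (snd c ` ?U)"
      by (rule open_chart_image[OF chart(1) \<open>open ?U\<close>]) auto
  qed (use chart c d e in \<open>auto simp: transition_def chart_inv\<close>)
  from frechet_derivative_at[OF this] show ?thesis by metis
qed

lemma tangent_vector_with_coords:
  assumes A: "smooth_manifold A" and c: "c \<in> A" "p \<in> fst c"
  obtains v where "v \<in> tangent_space A p" "v c = y"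
proof -
  define v where "v d = (if d \<in> A \<and> p \<in> fst d
    then frechet_derivative (transition c d) (at (snd c p)) y else 0)" for d
  have v: "v d = frechet_derivative (transition c d) (at (snd c p)) y"
    if "d \<in> A" "p \<in> fst d" for d
    using that by (simp add: v_def)
  have v0: "v d = 0" if "d \<notin> A \<or> p \<notin> fst d" for d
    using that by (auto simp: v_def)
  have "v c = y"
    using v[OF c] by (simp add: frechet_derivative_transition_refl[OF A c])
  moreover have "v e = frechet_derivative (transition d e) (at (snd d p)) (v d)"
    if d: "d \<in> A" "p \<in> fst d" and e: "e \<in> A" "p \<in> fst e" for d e
    unfolding v[OF d] v[OF e] by (rule frechet_derivative_transition_trans[OF A c d e])
  then have "v \<in> tangent_space A p"
    unfolding tangent_space_def using v0 by blast
  ultimately show thesis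
    using that by blast
qed

lemma tangent_vector_eqI:
  assumes "c \<in> A" "p \<in> fst c" "v \<in> tangent_space A p" "w \<in> tangent_space A p" "v c = w c"
  shows "v = w"
proof
  fix d
  show "v d = w d"
  proof (cases "d \<in> A \<and> p \<in> fst d")
    case True
    then have "u d = frechet_derivative (transition c d) (at (snd c p)) (u c)"
      if "u \<in> tangent_space A p" for u
      using assms(1,2) that unfolding tangent_space_def by blast
    then show ?thesis using assms(3-5) by metis
  next
    case False
    then have "u d = 0" if "u \<in> tangent_space A p" for u
      using that unfolding tangent_space_def by blast
    then show ?thesis using assms(3,4) by metis
  qed
qed

lemma coord_expr_eq:
  assumes A: "smooth_manifold A" and c: "c \<in> A" "p \<in> fst c" and v: "v \<in> tangent_space A p"
  shows "coord_expr A c F (snd c p, v c) = F (p, v)"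
proof -
  have "is_chart c" using A c unfolding smooth_manifold_def by blast
  then have "inj_on (induced_coords c) (Sigma (fst c) (tangent_space A))"
    using tangent_vector_eqI[OF c(1)]
    by (auto simp: inj_on_def induced_coords_def dest: inj_onD[OF chart_inj_on])
  moreover have "(p, v) \<in> Sigma (fst c) (tangent_space A)"
    using c v by simp
  ultimately have "inv_into (Sigma (fst c) (tangent_space A)) (induced_coords c)
      (induced_coords c (p, v)) = (p, v)"
    by (rule inv_into_f_f)
  then show ?thesis by (simp add: coord_expr_def induced_coords_def)
qed

lemma open_slit_domain: "is_chart c \<Longrightarrow> open (slit_domain c)"
  unfolding slit_domain_def is_chart_def by (intro open_Times) auto

lemma coord_expr_finsler_pos:
  assumes F: "finsler_space A F" and c: "c \<in> A" and z: "z \<in> slit_domain c"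
  shows "coord_expr A c F z > 0"
proof -
  have A: "smooth_manifold A" using F unfolding finsler_space_def by blast
  obtain p y where p: "p \<in> fst c" "z = (snd c p, y)" "y \<noteq> 0"
    using z unfolding slit_domain_def by auto
  obtain v where v: "v \<in> tangent_space A p" "v c = y"
    by (rule tangent_vector_with_coords[OF A c p(1)])
  have "(p, v) \<in> tangent_bundle A"
    using c p v by (auto simp: tangent_bundle_def carrier_def)
  moreover have "v \<noteq> (\<lambda>_. 0)"
    using v p by auto
  ultimately have "F (p, v) > 0"
    using F unfolding finsler_space_def by blast
  then show ?thesis
    using coord_expr_eq[OF A c p(1) v(1)] v(2) p(2) by simp
qed

text \<open>
  The left side does not mention the chart, so the vanishing of the coefficients at a point does not
  depend on the chart used to test it.
\<close>

lemma one_form_vanishes_iff: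
  assumes A: "smooth_manifold A" and \<beta>: "one_form A \<beta>" and c: "c \<in> A" "p \<in> fst c"
  shows "(\<forall>v\<in>tangent_space A p. \<beta> (p, v) = 0) \<longleftrightarrow> (\<forall>i. form_coeff A c \<beta> i (snd c p) = 0)"
    (is "?L \<longleftrightarrow> ?R")
proof
  show ?R if ?L
  proof
    fix i
    obtain v where v: "v \<in> tangent_space A p" "v c = axis i 1"
      by (rule tangent_vector_with_coords[OF A c])
    then show "form_coeff A c \<beta> i (snd c p) = 0"
      using that coord_expr_eq[OF A c v(1), of \<beta>] by (simp add: form_coeff_def)
  qed
  show ?L if ?R
  proof
    fix v assume v: "v \<in> tangent_space A p"
    have "\<beta> (p, v) = (\<Sum>i\<in>UNIV. form_coeff A c \<beta> i (snd c p) * v c $ i)"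
      using \<beta> c unfolding one_form_def coord_expr_eq[OF A c v, of \<beta>, symmetric] by auto
    with that show "\<beta> (p, v) = 0" by simp
  qed
qed

section \<open>Parallel 1-forms have no zeros\<close>

lemma open_chart_preimage:
  assumes c: "is_chart c" and V: "open V"
  shows "open {p \<in> fst c. snd c p \<in> V}"
proof -
  have "continuous_on (fst c) (snd c)" "open (fst c)"
    using c unfolding is_chart_def homeomorphism_def by auto
  then have "open (snd c -` V \<inter> fst c)"
    using V continuous_on_open_vimage by blast
  moreover have "{p \<in> fst c. snd c p \<in> V} = snd c -` V \<inter> fst c" by auto
  ultimately show ?thesis by simp
qed

text \<open>
  The coefficients of \<open>\<beta>\<close> solve a linear system whose coefficients \<open>G\<^sup>h\<^sub>i\<^sub>j(x, y)\<close> may be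
  read off at any fixed nonzero \<open>y\<close>; the choice \<open>y0 = (1, ..., 1)\<close> is arbitrary.
\<close>

lemma parallel_form_open_zero_set:
  fixes A :: "('m::{t2_space, second_countable_topology}, 'n::finite) chart set"
  assumes F: "finsler_space A F" and \<beta>: "parallel_form A F \<beta>" and c: "c \<in> A"
    and x0: "x0 \<in> snd c ` fst c" and zero: "\<And>i. form_coeff A c \<beta> i x0 = 0"
  shows "\<exists>r>0. \<forall>x\<in>ball x0 r. \<forall>i. form_coeff A c \<beta> i x = 0"
proof -
  have chart: "is_chart c"
    using F c unfolding finsler_space_def smooth_manifold_def by blast
  define y0 :: "real ^ 'n" where "y0 = (\<chi> i. 1)"
  have "y0 \<noteq> 0" by (simp add: y0_def vec_eq_iff)
  let ?f = "coord_expr A c F"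
  have slit: "(x, y0) \<in> slit_domain c" if "x \<in> snd c ` fst c" for x
    using that \<open>y0 \<noteq> 0\<close> by (simp add: slit_domain_def)
  have sm: "smooth_on (berwald_connection ?f h i j) (slit_domain c)" for h i j
    using F c unfolding finsler_space_def
    by (intro smooth_on_berwald_connection open_slit_domain[OF chart]) auto
  show ?thesis
  proof (rule open_zero_set_total_differential_system[where X = "snd c ` fst c"
        and \<Gamma> = "\<lambda>h i j x. berwald_connection ?f h i j (x, y0)"])
    show "open (snd c ` fst c)"
      using chart unfolding is_chart_def by blast
    show "form_coeff A c \<beta> i differentiable at x" if "x \<in> snd c ` fst c" for i x
      using \<beta> c that unfolding parallel_form_def one_form_def differentiable_def
      by (meson smooth_on_imp_has_derivative)
    show "continuous_on (snd c ` fst c) (\<lambda>x. berwald_connection ?f h i j (x, y0))" for h i j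
      by (rule continuous_on_compose2[OF smooth_on_imp_continuous_on[OF sm]])
         (auto intro!: continuous_intros slit)
    show "frechet_derivative (form_coeff A c \<beta> i) (at x) (axis j 1) =
        (\<Sum>h\<in>UNIV. berwald_connection ?f h i j (x, y0) * form_coeff A c \<beta> h x)"
      if "x \<in> snd c ` fst c" for i j x
      using \<beta> c slit[OF that] unfolding parallel_form_def by fastforce
  qed (use x0 zero in auto)
qed

text \<open>
  The two sets \<open>N\<close> and \<open>Z\<close> in the proof are defined by tangent vectors rather than by coefficients,
  which makes them disjoint; openness of each is checked in an arbitrary chart around a point.
\<close>

lemma parallel_form_no_zeros:
  fixes A :: "('m::{t2_space, second_countable_topology}, 'n::finite) chart set"
  assumes F: "finsler_space A F" and \<beta>: "parallel_form A F \<beta>" and nz: "nonzero_form A \<beta>"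
    and q: "q \<in> carrier A"
  shows "\<exists>v\<in>tangent_space A q. \<beta> (q, v) \<noteq> 0"
proof -
  have A: "smooth_manifold A" using F unfolding finsler_space_def by blast
  have \<beta>1: "one_form A \<beta>" using \<beta> unfolding parallel_form_def by blast
  define N where "N = {p \<in> carrier A. \<exists>v\<in>tangent_space A p. \<beta> (p, v) \<noteq> 0}"
  define Z where "Z = {p \<in> carrier A. \<forall>v\<in>tangent_space A p. \<beta> (p, v) = 0}"
  have chart: "is_chart c" if "c \<in> A" for c
    using A that unfolding smooth_manifold_def by blast
  have inA: "fst c \<subseteq> carrier A" if "c \<in> A" for c
    using that unfolding carrier_def by blast
  note iff = one_form_vanishes_iff[OF A \<beta>1]
  have "open N"
  proof (subst open_subopen, intro ballI)
    fix p assume "p \<in> N"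
    then obtain c where c: "c \<in> A" "p \<in> fst c"
      unfolding N_def carrier_def by blast
    with \<open>p \<in> N\<close> obtain i where i: "form_coeff A c \<beta> i (snd c p) \<noteq> 0"
      using iff[OF c] unfolding N_def by blast
    let ?X = "snd c ` fst c"
    let ?V = "?X \<inter> form_coeff A c \<beta> i -` (- {0})"
    have "open ?X" using chart[OF c(1)] unfolding is_chart_def by blast
    moreover have "continuous_on ?X (form_coeff A c \<beta> i)"
      using \<beta>1 c unfolding one_form_def by (auto intro: smooth_on_imp_continuous_on)
    ultimately have "open ?V"
      by (intro continuous_open_preimage) auto
    then have "open {p \<in> fst c. snd c p \<in> ?V}"
      by (rule open_chart_preimage[OF chart[OF c(1)]])
    moreover have "{p \<in> fst c. snd c p \<in> ?V} \<subseteq> N"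
      using iff[OF c(1)] inA[OF c(1)] unfolding N_def by blast
    ultimately show "\<exists>T. open T \<and> p \<in> T \<and> T \<subseteq> N"
      using c i by blast
  qed
  have "open Z"
  proof (subst open_subopen, intro ballI)
    fix p assume "p \<in> Z"
    then obtain c where c: "c \<in> A" "p \<in> fst c"
      unfolding Z_def carrier_def by blast
    with \<open>p \<in> Z\<close> have "form_coeff A c \<beta> i (snd c p) = 0" for i
      using iff[OF c] unfolding Z_def by blast
    then obtain r where r: "r > 0" "\<forall>x\<in>ball (snd c p) r. \<forall>i. form_coeff A c \<beta> i x = 0"
      using parallel_form_open_zero_set[OF F \<beta> c(1)] c(2) by blast
    have "open {p' \<in> fst c. snd c p' \<in> ball (snd c p) r}"
      by (rule open_chart_preimage[OF chart[OF c(1)]]) simp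
    moreover have "{p' \<in> fst c. snd c p' \<in> ball (snd c p) r} \<subseteq> Z"
      using iff[OF c(1)] r(2) inA[OF c(1)] unfolding Z_def by blast
    ultimately show "\<exists>T. open T \<and> p \<in> T \<and> T \<subseteq> Z"
      using c r(1) by (intro exI[of _ "{p' \<in> fst c. snd c p' \<in> ball (snd c p) r}"]) auto
  qed
  let ?C = "connected_component_set (carrier A) q"
  have C: "?C \<in> components (carrier A)"
    using q by (rule componentsI)
  then obtain p where p: "p \<in> ?C" "\<exists>v\<in>tangent_space A p. \<beta> (p, v) \<noteq> 0"
    using nz unfolding nonzero_form_def by blast
  have sub: "?C \<subseteq> carrier A"
    by (rule connected_component_subset)
  have "p \<in> N" using p sub unfolding N_def by blast
  have "?C \<subseteq> N \<union> Z" using sub unfolding N_def Z_def by blast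
  moreover have "N \<inter> Z \<inter> ?C = {}" unfolding N_def Z_def by blast
  ultimately have "N \<inter> ?C = {} \<or> Z \<inter> ?C = {}"
    by (intro connectedD connected_connected_component \<open>open N\<close> \<open>open Z\<close>)
  then have "Z \<inter> ?C = {}" using \<open>p \<in> N\<close> p(1) by blast
  moreover have "q \<in> ?C" using q by simp
  ultimately show ?thesis using q unfolding Z_def by blast
qed

section \<open>Landsberg surfaces with a parallel 1-form\<close>

theorem theorem3p4:
  fixes A :: "('m::{t2_space, second_countable_topology}, 2) chart set"
    and F \<beta> :: "'m \<times> ('m, 2) tangent_vector \<Rightarrow> real"
  assumes "landsberg_space A F"
    and "parallel_form A F \<beta>" and "nonzero_form A \<beta>"
  shows "berwald_space A F"
proof -
  have F: "finsler_space A F"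
    using assms(1) unfolding landsberg_space_def by blast
  then have A: "smooth_manifold A"
    unfolding finsler_space_def by blast
  have "berwald_curvature (coord_expr A c F) h i j k z = 0"
    if c: "c \<in> A" and z: "z \<in> slit_domain c" for c z h i j k
  proof -
    let ?f = "coord_expr A c F"
    obtain p y where p: "p \<in> fst c" "z = (snd c p, y)"
      using z unfolding slit_domain_def by auto
    have "p \<in> carrier A" using c p unfolding carrier_def by blast
    with parallel_form_no_zeros[OF F assms(2,3)]
    obtain m where m: "form_coeff A c \<beta> m (snd c p) \<noteq> 0"
      using one_form_vanishes_iff[OF A _ c p(1)] assms(2) unfolding parallel_form_def by blast
    have op: "open (slit_domain c)"
      using A c unfolding smooth_manifold_def by (blast intro: open_slit_domain)
    have "berwald_curvature ?f h i j k (snd c p, y) = 0"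
    proof (rule landsberg_surface_with_parallel_form_at[OF op, where f = ?f
          and a = "\<lambda>h. form_coeff A c \<beta> h (snd c p)"])
      show "(\<Sum>h\<in>UNIV. berwald_connection ?f h i j (snd c p, w) * form_coeff A c \<beta> h (snd c p)) =
          frechet_derivative (form_coeff A c \<beta> i) (at (snd c p)) (axis j 1)"
        if "(snd c p, w) \<in> slit_domain c" for w
        using assms(2) c that unfolding parallel_form_def by fastforce
      show "landsberg_curvature ?f i j k z = 0" if "z \<in> slit_domain c" for z
        using assms(1) c that unfolding landsberg_space_def by blast
      show "?f z > 0" if "z \<in> slit_domain c" for z
        by (rule coord_expr_finsler_pos[OF F c that])
    qed (use F c z p m in \<open>auto simp: finsler_space_def\<close>)
    with p show ?thesis by simp
  qed
  with F show ?thesis unfolding berwald_space_def by blast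
qed

end
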